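(* Let $m,n$ be positive integers with $m\neq n$. Any graph $G\in\overline G_{m,n}$ is 2-connected.
   Context: All graphs are finite and simple. For positive integers $m,n$, $G_{m,n}$ denotes the class of all simple graphs that have the same degree sequence as the disjoint union $K_m\cup K_n$ of two cliques but are not isomorphic to $K_m\cup K_n$. $\overline G_{m,n}$ denotes the class of complements of graphs in $G_{m,n}$; equivalently, the graphs on $m+n$ vertices with $n$ vertices of degree $m$ and $m$ further vertices of degree $n$ that are not isomorphic to the complete bipartite graph $K_{m,n}$. A graph is 2-connected if it is connected and cannot be disconnected by removing a single vertex. *)

theory Defs
  imports "Graph_Theory.Graph_Theory" "HOL-Library.Multiset"
begin

text \<open>
  A finite simple graph is a \<open>pair_graph\<close>: a finite, loop-free, symmetric digraph whose arcs are
  pairs of vertices, so an edge \<open>uv\<close> is represented by the two arcs \<open>(u, v)\<close> and \<open>(v, u)\<close>.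
  On such graphs \<open>digraph_iso\<close> is ordinary graph isomorphism.
\<close>

definition clique :: "nat \<Rightarrow> nat pair_pre_digraph" where
  "clique n = \<lparr>pverts = {..<n}, parcs = {(u, v). u < n \<and> v < n \<and> u \<noteq> v}\<rparr>"

definition disjoint_union ::
    "'a pair_pre_digraph \<Rightarrow> 'b pair_pre_digraph \<Rightarrow> ('a + 'b) pair_pre_digraph" where
  "disjoint_union G H =
     \<lparr>pverts = pverts G <+> pverts H,
      parcs = {(Inl u, Inl v) |u v. (u, v) \<in> parcs G} \<union> {(Inr u, Inr v) |u v. (u, v) \<in> parcs H}\<rparr>"

definition graph_complement :: "'a pair_pre_digraph \<Rightarrow> 'a pair_pre_digraph" where
  "graph_complement G =
     \<lparr>pverts = pverts G,
      parcs = {(u, v). u \<in> pverts G \<and> v \<in> pverts G \<and> u \<noteq> v \<and> (u, v) \<notin> parcs G}\<rparr>"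

text \<open>
  Degree sequences are taken up to order. Since the arc relation is symmetric, the out-degree of a
  vertex is its degree in the undirected graph.
\<close>

definition degree_sequence :: "'a pair_pre_digraph \<Rightarrow> nat multiset" where
  "degree_sequence G = image_mset (out_degree (with_proj G)) (mset_set (pverts G))"

definition G_class :: "nat \<Rightarrow> nat \<Rightarrow> 'a pair_pre_digraph set" where
  "G_class m n =
     {G. pair_graph G
       \<and> degree_sequence G = degree_sequence (disjoint_union (clique m) (clique n))
       \<and> \<not> digraph_iso (with_proj G) (with_proj (disjoint_union (clique m) (clique n)))}"

definition co_G_class :: "nat \<Rightarrow> nat \<Rightarrow> 'a pair_pre_digraph set" where
  "co_G_class m n = graph_complement ` G_class m n"

definition two_connected :: "'a pair_pre_digraph \<Rightarrow> bool" where
  "two_connected G \<longleftrightarrow>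
     Digraph_Component.connected (with_proj G)
       \<and> (\<forall>v \<in> pverts G. Digraph_Component.connected (pre_digraph.del_vert (with_proj G) v))"

lemma complete_digraph_clique: "complete_digraph n (with_proj (clique n))"
  by (auto simp: complete_digraph_pair_def clique_def)

lemma pair_graph_graph_complement:
  assumes "pair_graph G"
  shows "pair_graph (graph_complement G)"
proof -
  interpret pair_graph G by fact
  have *: "parcs (graph_complement G) \<subseteq> pverts G \<times> pverts G"
    by (auto simp: graph_complement_def)
  have fin: "finite (parcs (graph_complement G))"
    by (rule finite_subset[OF *]) auto
  have sym: "symmetric (with_proj (graph_complement G))"
    using pair_sym_arcs by (auto simp: symmetric_def graph_complement_def sym_def)
  show ?thesis
    by unfold_locales (use fin sym in \<open>auto simp: graph_complement_def\<close>)
qed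

lemma graph_complement_involution:
  assumes "pair_graph G"
  shows "graph_complement (graph_complement G) = G"
proof -
  interpret pair_graph G by fact
  show ?thesis
    by (cases G) (use wellformed' pair_no_loops in \<open>fastforce simp: graph_complement_def\<close>)
qed

lemma complete_bipartite_complement_cliques:
  "complete_bipartite_digraph m n
     (with_proj (graph_complement (disjoint_union (clique m) (clique n))))"
  unfolding complete_bipartite_digraph_pair_def
  by (intro conjI exI[of _ "Inl ` {..<m}"] exI[of _ "Inr ` {..<n}"])
    (auto simp: graph_complement_def disjoint_union_def clique_def card_image)

end

theory Submission
  imports Defs
begin

text \<open>
  Write \<open>K\<close> for the graph in question: it has \<open>m + n\<close> vertices, of which \<open>m\<close> have degree \<open>n\<close> and
  \<open>n\<close> have degree \<open>m\<close>. Connectivity is a matter of counting closed neighbourhoods. Let \<open>c\<close> be a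
  vertex of the larger degree \<open>max m n\<close>. The component of \<open>c\<close> has more than \<open>max m n\<close> vertices;
  a second component would have more than \<open>min m n\<close> vertices, since that is the minimum degree. The
  two together exceed the \<open>m + n\<close> available vertices (lemma \<open>connected_if_large_neighbourhoods\<close>).

  The count still works after the deletion of a vertex \<open>v\<close>. Each degree drops by at most one, so two
  components of \<open>K - v\<close> would need \<open>max m n + min m n\<close> vertices, and there are only \<open>m + n - 1\<close>.
  What this requires is a vertex of degree \<open>max m n\<close> other than \<open>v\<close> (lemma
  \<open>two_connected_if_large_degrees\<close>). As \<open>min m n\<close> vertices have degree \<open>max m n\<close>, it remains to
  exclude \<open>min m n = 1\<close>.

  This is where the assumption that \<open>K\<close> is not \<open>K\<^sub>m\<^sub>,\<^sub>n\<close> enters. If \<open>m = 1\<close> or \<open>n = 1\<close>, then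
  the complement of \<open>K\<close> has an isolated vertex, so its two degree classes are not joined by
  any edge there, and the degrees force both classes to be cliques (lemma \<open>arcs_of_two_cliques\<close>).
\<close>

section \<open>Degrees\<close>

lemma out_degree_with_proj:
  "out_degree (with_proj G) u = card {v. (u, v) \<in> parcs G}"
proof -
  have "out_arcs (with_proj G) u = Pair u ` {v. (u, v) \<in> parcs G}"
    by (auto simp: out_arcs_def)
  then show ?thesis
    by (simp add: out_degree_def card_image inj_on_def)
qed

lemma card_degree_class:
  assumes "finite (pverts G)"
  shows "card {u \<in> pverts G. out_degree (with_proj G) u = k} = count (degree_sequence G) k"
proof -
  have "count (degree_sequence G) k = (\<Sum>u | u \<in> pverts G \<and> k = out_degree (with_proj G) u. 1)"
    unfolding degree_sequence_def count_image_mset'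
    by (rule sum.cong) (use assms in auto)
  then show ?thesis by (simp add: eq_commute)
qed

lemma degree_sequence_two_cliques:
  "degree_sequence (disjoint_union (clique m) (clique n)) =
     replicate_mset m (m - 1) + replicate_mset n (n - 1)"
proof -
  let ?D = "disjoint_union (clique m) (clique n)"
  have l: "out_degree (with_proj ?D) (Inl i) = m - 1" if "i < m" for i
  proof -
    have "{v. (Inl i, v) \<in> parcs ?D} = Inl ` ({..<m} - {i})"
      using that by (auto simp: disjoint_union_def clique_def)
    with that show ?thesis by (simp add: out_degree_with_proj card_image)
  qed
  have r: "out_degree (with_proj ?D) (Inr i) = n - 1" if "i < n" for i
  proof -
    have "{v. (Inr i, v) \<in> parcs ?D} = Inr ` ({..<n} - {i})"
      using that by (auto simp: disjoint_union_def clique_def)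
    with that show ?thesis by (simp add: out_degree_with_proj card_image)
  qed
  have split: "mset_set (pverts ?D) =
      image_mset Inl (mset_set {..<m}) + image_mset Inr (mset_set {..<n})"
    by (auto simp: disjoint_union_def clique_def Plus_def image_mset_mset_set
        intro!: mset_set_Union)
  have "image_mset (\<lambda>i. out_degree (with_proj ?D) (Inl i)) (mset_set {..<m}) =
      image_mset (\<lambda>_. m - 1) (mset_set {..<m})"
    by (rule image_mset_cong) (simp add: l)
  moreover have "image_mset (\<lambda>i. out_degree (with_proj ?D) (Inr i)) (mset_set {..<n}) =
      image_mset (\<lambda>_. n - 1) (mset_set {..<n})"
    by (rule image_mset_cong) (simp add: r)
  ultimately show ?thesis
    unfolding degree_sequence_def split
    by (simp add: multiset.map_comp comp_def image_mset_const_eq)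
qed

lemma out_degree_complement:
  assumes "pair_graph G" "u \<in> pverts G"
  shows "out_degree (with_proj (graph_complement G)) u + out_degree (with_proj G) u + 1 =
    card (pverts G)"
proof -
  interpret pair_graph G by fact
  let ?N = "{v. (u, v) \<in> parcs G}" and ?M = "{v. (u, v) \<in> parcs (graph_complement G)}"
  have part: "pverts G = insert u (?M \<union> ?N)"
    using assms(2) wellformed' by (auto simp: graph_complement_def)
  have fin: "finite (?M \<union> ?N)"
    by (rule finite_subset[OF _ pair_finite_verts]) (use part in blast)
  have "u \<notin> ?M \<union> ?N" "?M \<inter> ?N = {}"
    using no_loops' by (auto simp: graph_complement_def)
  with fin have "card (insert u (?M \<union> ?N)) = card ?M + card ?N + 1"
    by (simp add: card_Un_disjoint)
  then show ?thesis
    by (simp only: out_degree_with_proj flip: part)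
qed

section \<open>Connectivity by counting neighbourhoods\<close>

text \<open>
  Two different components contain the closed neighbourhoods of their vertices, hence have at least
  \<open>b\<close> (for the component of \<open>c\<close>) and at least \<open>a\<close> vertices: too many. Bounding closed neighbourhoods,
  and not degrees, keeps subtraction out of the application to a graph with a vertex deleted.
\<close>
lemma connected_if_large_neighbourhoods:
  assumes "pair_graph K"
    and small: "card (pverts K) < a + b"
    and all: "\<And>u. u \<in> pverts K \<Longrightarrow> a \<le> out_degree (with_proj K) u + 1"
    and c: "c \<in> pverts K" "b \<le> out_degree (with_proj K) c + 1"
  shows "Digraph_Component.connected (with_proj K)"
proof -
  interpret pair_graph K by fact
  define R where "R = {x. c \<rightarrow>\<^sup>*\<^bsub>K\<^esub> x}"
  let ?cl = "\<lambda>u. insert u {v. (u, v) \<in> parcs K}"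
  have fin: "finite {v. (u, v) \<in> parcs K}" for u
    by (rule finite_subset[OF _ pair_finite_verts]) (use wellformed' in auto)
  have card_cl: "card (?cl u) = out_degree (with_proj K) u + 1" for u
    using fin no_loops' by (subst card_insert_disjoint) (auto simp: out_degree_with_proj)
  have R_sub: "R \<subseteq> pverts K"
    using reachable_in_verts(2) unfolding R_def by blast
  have R_step: "v \<in> R" if "u \<in> R" "(u, v) \<in> parcs K" for u v
    using that by (auto simp: R_def intro: reachable_adj_trans)
  have cl_c: "?cl c \<subseteq> R"
    using c(1) R_step by (auto simp: R_def)
  have "R = pverts K"
  proof (rule ccontr)
    assume "R \<noteq> pverts K"
    then obtain y where y: "y \<in> pverts K" "y \<notin> R" using R_sub by blast
    have cl_y: "?cl y \<subseteq> pverts K - R"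
      using y R_step arcs_symmetric wellformed' by blast
    have "b \<le> card R"
      using c(2) card_cl[of c] card_mono[OF finite_subset[OF R_sub pair_finite_verts] cl_c] by simp
    moreover have "a \<le> card (pverts K - R)"
      using all[OF y(1)] card_cl[of y] card_mono[OF _ cl_y] by simp
    moreover have "card (pverts K) = card R + card (pverts K - R)"
      using card_Diff_subset[OF finite_subset[OF R_sub pair_finite_verts] R_sub]
        card_mono[OF pair_finite_verts R_sub] by linarith
    ultimately show False using small by linarith
  qed
  then have "u \<rightarrow>\<^sup>*\<^bsub>K\<^esub> v" if "u \<in> pverts K" "v \<in> pverts K" for u v
    using that symmetric_reachable[OF sym_arcs] reachable_trans unfolding R_def by blast
  then have "strongly_connected (with_proj K)"
    using c(1) by (intro strongly_connectedI) auto
  moreover have "mk_symmetric (with_proj K) = K"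
    by (cases K) (use arcs_symmetric in \<open>force simp: mk_symmetric_def\<close>)
  ultimately show ?thesis by (simp add: connected_def)
qed

text \<open>
  Having two vertices of degree at least \<open>D\<close> guarantees that one of them survives the deletion of
  any vertex.
\<close>
lemma two_connected_if_large_degrees:
  assumes "pair_graph K"
    and card: "card (pverts K) \<le> d + D"
    and all: "\<And>u. u \<in> pverts K \<Longrightarrow> d \<le> out_degree (with_proj K) u"
    and two: "2 \<le> card {u \<in> pverts K. D \<le> out_degree (with_proj K) u}"
  shows "two_connected K"
proof -
  interpret pair_graph K by fact
  let ?C = "{u \<in> pverts K. D \<le> out_degree (with_proj K) u}"
  have survivor: "\<exists>c \<in> ?C. c \<noteq> v" for v
  proof (rule ccontr)
    assume "\<not> ?thesis"
    then have "?C \<subseteq> {v}" by blast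
    then have "card ?C \<le> 1" using card_mono[of "{v}" ?C] by simp
    with two show False by simp
  qed
  have "Digraph_Component.connected (with_proj K)"
  proof -
    from survivor obtain c where "c \<in> ?C" by blast
    with all card show ?thesis
      by (intro connected_if_large_neighbourhoods[OF assms(1), of "d + 1" "D + 1" c]) auto
  qed
  moreover have "Digraph_Component.connected (del_vert v)" if v: "v \<in> pverts K" for v
  proof -
    define K' where
      "K' = \<lparr>pverts = pverts K - {v}, parcs = {(x, y) \<in> parcs K. x \<noteq> v \<and> y \<noteq> v}\<rparr>"
    have del: "del_vert v = with_proj K'"
      by (auto simp: pre_digraph.del_vert_def with_proj_def K'_def)
    have sub: "parcs K' \<subseteq> parcs K" by (auto simp: K'_def)
    have sym: "symmetric (with_proj K')"
      using arcs_symmetric by (auto simp: symmetric_def K'_def intro!: symI)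
    have K': "pair_graph K'"
      by unfold_locales
        (use sym sub finite_subset[OF sub pair_finite_arcs] wellformed' no_loops' pair_finite_verts
          in \<open>auto simp: K'_def\<close>)
    have deg: "out_degree (with_proj K) u \<le> out_degree (with_proj K') u + 1" if "u \<noteq> v" for u
    proof -
      have "{w. (u, w) \<in> parcs K'} = {w. (u, w) \<in> parcs K} - {v}"
        using that by (auto simp: K'_def)
      then show ?thesis
        by (simp add: out_degree_with_proj card_Diff_singleton_if) arith
    qed
    obtain c where "c \<in> ?C" "c \<noteq> v" using survivor by blast
    moreover have "card (pverts K') < d + D"
    proof -
      have "card (pverts K') = card (pverts K) - 1" by (simp add: K'_def v)
      moreover have "0 < card (pverts K)" using v pair_finite_verts by (auto simp: card_gt_0_iff)
      ultimately show ?thesis using card by simp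
    qed
    ultimately show ?thesis
      unfolding del
      by (intro connected_if_large_neighbourhoods[OF K', of d D c])
        (use all deg in \<open>auto simp: K'_def intro: order_trans\<close>)
  qed
  ultimately show ?thesis by (simp add: two_connected_def)
qed

section \<open>Disjoint unions of two cliques\<close>

lemma digraph_iso_with_projI:
  assumes "pair_wf_digraph G" "pair_wf_digraph H"
    and bij: "bij_betw f (pverts G) (pverts H)"
    and adj: "\<And>u v. u \<in> pverts G \<Longrightarrow> v \<in> pverts G \<Longrightarrow>
      (u, v) \<in> parcs G \<longleftrightarrow> (f u, f v) \<in> parcs H"
  shows "digraph_iso (with_proj G) (with_proj H)"
proof -
  interpret G: pair_wf_digraph G by fact
  interpret H: pair_wf_digraph H by fact
  let ?h = "\<lparr>iso_verts = f, iso_arcs = map_prod f f, iso_head = snd, iso_tail = fst\<rparr>"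
  have inj: "inj_on f (pverts G)" and im: "f ` pverts G = pverts H"
    using bij by (auto simp: bij_betw_def)
  have "inj_on (map_prod f f) (parcs G)"
    by (rule inj_on_subset[OF map_prod_inj_on[OF inj inj]]) (use G.wellformed' in auto)
  then have "G.digraph_isomorphism ?h"
    by (auto simp: G.digraph_isomorphism_def inj G.wf_digraph)
  moreover have "map_prod f f ` parcs G = parcs H"
  proof (intro equalityI subsetI)
    fix e assume "e \<in> map_prod f f ` parcs G"
    then obtain u v where "(u, v) \<in> parcs G" "e = (f u, f v)" by force
    then show "e \<in> parcs H" using adj[of u v] G.wellformed'[of u v] by simp
  next
    fix e assume e: "e \<in> parcs H"
    obtain x y where xy: "e = (x, y)" by (cases e)
    then obtain u v where "u \<in> pverts G" "v \<in> pverts G" "x = f u" "y = f v"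
      using e H.wellformed' im by (metis imageE)
    with e xy adj[of u v] have "(u, v) \<in> parcs G" "e = map_prod f f (u, v)" by simp_all
    then show "e \<in> map_prod f f ` parcs G" by blast
  qed
  then have "with_proj H = app_iso ?h (with_proj G)"
    by (auto simp: app_iso_def with_proj_def im)
  ultimately show ?thesis unfolding digraph_iso_def by blast
qed

text \<open>
  A vertex without neighbours outside its class has at most as many neighbours as the class has other
  vertices; the degrees say that this bound is attained.
\<close>
lemma arcs_of_two_cliques:
  assumes "pair_graph H"
    and verts: "pverts H = A \<union> B"
    and sep: "\<And>u v. u \<in> A \<Longrightarrow> v \<in> B \<Longrightarrow> (u, v) \<notin> parcs H"
    and degA: "\<And>u. u \<in> A \<Longrightarrow> out_degree (with_proj H) u = card A - 1"
    and degB: "\<And>u. u \<in> B \<Longrightarrow> out_degree (with_proj H) u = card B - 1"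
  shows "parcs H = {(u, v). u \<noteq> v \<and> (u \<in> A \<and> v \<in> A \<or> u \<in> B \<and> v \<in> B)}"
proof -
  interpret pair_graph H by fact
  have "finite A" "finite B" using verts pair_finite_verts by auto
  have full: "{v. (u, v) \<in> parcs H} = S - {u}"
    if "u \<in> S" "finite S" "{v. (u, v) \<in> parcs H} \<subseteq> S"
      "out_degree (with_proj H) u = card S - 1" for u S
    by (rule card_subset_eq) (use that no_loops' in \<open>auto simp: out_degree_with_proj\<close>)
  have A: "{v. (u, v) \<in> parcs H} = A - {u}" if "u \<in> A" for u
    by (rule full) (use that sep verts wellformed' degA \<open>finite A\<close> in blast)+
  have B: "{v. (u, v) \<in> parcs H} = B - {u}" if "u \<in> B" for u
    by (rule full) (use that sep arcs_symmetric verts wellformed' degB \<open>finite B\<close> in blast)+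
  have "(u, v) \<in> parcs H \<longleftrightarrow> u \<noteq> v \<and> (u \<in> A \<and> v \<in> A \<or> u \<in> B \<and> v \<in> B)" for u v
  proof -
    have "(u, v) \<in> parcs H \<longleftrightarrow> v \<in> A - {u}" if "u \<in> A" using A[OF that] by blast
    moreover have "(u, v) \<in> parcs H \<longleftrightarrow> v \<in> B - {u}" if "u \<in> B" using B[OF that] by blast
    moreover have "u \<in> A \<or> u \<in> B" if "(u, v) \<in> parcs H"
      using in_arcsD1[OF that] verts by simp
    ultimately show ?thesis by blast
  qed
  then show ?thesis by auto
qed

lemma iso_two_cliques:
  assumes "pair_graph H"
    and verts: "pverts H = A \<union> B" and disj: "A \<inter> B = {}"
    and arcs: "parcs H = {(u, v). u \<noteq> v \<and> (u \<in> A \<and> v \<in> A \<or> u \<in> B \<and> v \<in> B)}"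
  shows "digraph_iso (with_proj H)
    (with_proj (disjoint_union (clique (card A)) (clique (card B))))"
proof -
  interpret pair_graph H by fact
  have "finite A" "finite B" using verts pair_finite_verts by auto
  then obtain g h where g: "bij_betw g A {..<card A}" and h: "bij_betw h B {..<card B}"
    by (metis ex_bij_betw_finite_nat atLeast0LessThan)
  define f where "f u = (if u \<in> A then Inl (g u) else Inr (h u))" for u
  have fA: "f u = Inl (g u)" if "u \<in> A" for u using that by (simp add: f_def)
  have fB: "f u = Inr (h u)" if "u \<in> B" for u using that disj by (auto simp: f_def)
  have gl: "g u < card A" if "u \<in> A" for u using that g by (auto simp: bij_betw_def)
  have hl: "h u < card B" if "u \<in> B" for u using that h by (auto simp: bij_betw_def)
  have ge: "g u = g v \<longleftrightarrow> u = v" if "u \<in> A" "v \<in> A" for u v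
    using that g by (auto simp: bij_betw_def inj_on_eq_iff)
  have he: "h u = h v \<longleftrightarrow> u = v" if "u \<in> B" "v \<in> B" for u v
    using that h by (auto simp: bij_betw_def inj_on_eq_iff)
  let ?D = "disjoint_union (clique (card A)) (clique (card B))"
  have "inj_on f (A \<union> B)"
    using ge he by (auto simp: inj_on_def fA fB)
  moreover have "f ` (A \<union> B) = Inl ` g ` A \<union> Inr ` h ` B"
    by (force simp: fA fB image_Un image_iff)
  ultimately have "bij_betw f (pverts H) (pverts ?D)"
    using g h by (simp add: verts bij_betw_def disjoint_union_def clique_def Plus_def)
  moreover have "(u, v) \<in> parcs H \<longleftrightarrow> (f u, f v) \<in> parcs ?D"
    if "u \<in> pverts H" "v \<in> pverts H" for u v
    using that disj gl hl ge he
    by (auto simp: verts arcs disjoint_union_def clique_def fA fB)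
  moreover have "pair_wf_digraph ?D"
    by unfold_locales (auto simp: disjoint_union_def clique_def)
  ultimately show ?thesis
    by (intro digraph_iso_with_projI pair_wf_digraph)
qed

section \<open>Graphs with the degree sequence of two cliques\<close>

lemma degree_classes_two_cliques:
  assumes "finite (pverts H)" and "m \<noteq> n" "m > 0" "n > 0"
    and seq: "degree_sequence H = degree_sequence (disjoint_union (clique m) (clique n))"
  defines "A \<equiv> {u \<in> pverts H. out_degree (with_proj H) u = m - 1}"
    and "B \<equiv> {u \<in> pverts H. out_degree (with_proj H) u = n - 1}"
  shows "pverts H = A \<union> B" "A \<inter> B = {}" "card A = m" "card B = n"
proof -
  have "out_degree (with_proj H) u \<in># degree_sequence H" if "u \<in> pverts H" for u
    using that assms(1) by (auto simp: degree_sequence_def)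
  then show "pverts H = A \<union> B"
    using assms(3,4)
    by (fastforce simp: A_def B_def seq degree_sequence_two_cliques)
  show "A \<inter> B = {}" using assms(2-4) by (auto simp: A_def B_def)
  show "card A = m" "card B = n"
    using assms(2-4)
    by (auto simp: A_def B_def card_degree_class[OF assms(1)] seq degree_sequence_two_cliques)
qed

theorem proposition6:
  fixes m n :: nat and G :: "'a pair_pre_digraph"
  assumes "m > 0" and "n > 0" and "m \<noteq> n"
    and "G \<in> co_G_class m n"
  shows "two_connected G"
proof -
  obtain H where G: "G = graph_complement H" and H: "pair_graph H"
    and seq: "degree_sequence H = degree_sequence (disjoint_union (clique m) (clique n))"
    and not_iso: "\<not> digraph_iso (with_proj H) (with_proj (disjoint_union (clique m) (clique n)))"
    using assms(4) by (auto simp: co_G_class_def G_class_def)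
  interpret H: pair_graph H by fact
  define A where "A = {u \<in> pverts H. out_degree (with_proj H) u = m - 1}"
  define B where "B = {u \<in> pverts H. out_degree (with_proj H) u = n - 1}"
  have verts: "pverts H = A \<union> B" and disj: "A \<inter> B = {}"
    and cA: "card A = m" and cB: "card B = n"
    using degree_classes_two_cliques[OF H.pair_finite_verts assms(3,1,2) seq]
    by (simp_all add: A_def B_def)
  have fin: "finite A" "finite B" using verts H.pair_finite_verts by auto
  have card: "card (pverts H) = m + n"
    using card_Un_disjoint[OF fin disj] by (simp only: verts cA cB)
  have joined: "\<exists>u\<in>A. \<exists>v\<in>B. (u, v) \<in> parcs H"
  proof (rule ccontr)
    assume "\<not> ?thesis"
    then have "parcs H = {(u, v). u \<noteq> v \<and> (u \<in> A \<and> v \<in> A \<or> u \<in> B \<and> v \<in> B)}"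
      by (intro arcs_of_two_cliques[OF H verts]) (auto simp: cA cB, auto simp: A_def B_def)
    from iso_two_cliques[OF H verts disj this] not_iso show False
      by (simp add: cA cB)
  qed
  \<comment> \<open>The ends of an edge between the classes have positive degrees \<open>m - 1\<close> and \<open>n - 1\<close> in \<open>H\<close>.\<close>
  have "2 \<le> min m n"
  proof -
    from joined obtain u v where uv: "u \<in> A" "v \<in> B" "(u, v) \<in> parcs H" by blast
    have pos: "out_degree (with_proj H) x \<noteq> 0" if "(x, y) \<in> parcs H" for x y
    proof -
      have "finite {z. (x, z) \<in> parcs H}"
        by (rule finite_subset[OF _ H.pair_finite_verts]) (use H.wellformed' in auto)
      with that show ?thesis by (auto simp: out_degree_with_proj)
    qed
    have "m - 1 \<noteq> 0" using pos[OF uv(3)] uv(1) by (simp add: A_def)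
    moreover have "n - 1 \<noteq> 0" using pos[OF H.arcs_symmetric[OF uv(3)]] uv(2) by (simp add: B_def)
    ultimately show ?thesis by simp
  qed
  have degA: "out_degree (with_proj G) u = n" if "u \<in> A" for u
    using out_degree_complement[OF H, of u] that assms(1) by (simp add: G card A_def)
  have degB: "out_degree (with_proj G) u = m" if "u \<in> B" for u
    using out_degree_complement[OF H, of u] that assms(2) by (simp add: G card B_def)
  have vertsG: "pverts G = A \<union> B" by (simp add: G verts graph_complement_def)
  show ?thesis
  proof (rule two_connected_if_large_degrees[where d = "min m n" and D = "max m n"])
    show "pair_graph G" unfolding G by (rule pair_graph_graph_complement[OF H])
    show "card (pverts G) \<le> min m n + max m n" using card by (simp add: vertsG verts)
    show "min m n \<le> out_degree (with_proj G) u" if "u \<in> pverts G" for u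
      using that degA degB by (auto simp: vertsG)
    have "{u \<in> pverts G. max m n \<le> out_degree (with_proj G) u} = (if m < n then A else B)"
      using degA degB assms(3) disj by (auto simp: vertsG)
    then show "2 \<le> card {u \<in> pverts G. max m n \<le> out_degree (with_proj G) u}"
      using \<open>2 \<le> min m n\<close> by (simp add: cA cB)
  qed
qed

end
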